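(* Let $P\in\mathcal{A}$ be an orthogonal projection with trace $\tau(P)=\kappa\in(0,1]$, free from the free positive Brownian motion $(h_t)_{t\ge0}$ in $(\mathcal{A},\tau)$, and let $j_t:=Ph_tPh_t^{-1}P$. For any $t\ge0$, the spectrum of $j_t$ in the compressed algebra $P\mathcal{A}P$ (whose unit is $P$) satisfies $\sigma(j_t)\subset[1,+\infty)$.
   Context: $(\mathcal{A},\tau)$ is a non-commutative probability space: a unital von Neumann algebra with a faithful normal tracial state. The (left) free multiplicative Brownian motion $(g_t)_{t\ge0}$ is the unique solution of the free SDE $dg_t=g_t\,dc_t$, $g_0=1_{\mathcal{A}}$, where $(c_t)_{t\ge0}$ is a free circular Brownian motion normalized by $\tau(c_tc_t^{\star})=t$; the free positive Brownian motion is $h_t=g_tg_t^{\star}$, a positive bounded operator that is invertible for every $t\ge0$. The process $(j_t)_{t\ge0}$, valued in the compressed probability space $(P\mathcal{A}P,\tau/\tau(P))$, is called the free non-compact Jacobi process. *)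

theory Defs
  imports "HOL-Analysis.Analysis"
begin

section \<open>Complex Hilbert spaces and bounded operators\<close>

text \<open>The inner product is linear in its second argument. The equation \<open>cinner_self\<close> gives
  positive definiteness and ties the inner product to the (complete) norm.\<close>

class chilbert_space = banach +
  fixes scaleC :: "complex \<Rightarrow> 'a \<Rightarrow> 'a"  (infixr \<open>*\<^sub>C\<close> 75)
    and cinner :: "'a \<Rightarrow> 'a \<Rightarrow> complex"
  assumes scaleC_of_real: "complex_of_real r *\<^sub>C x = r *\<^sub>R x"
    and scaleC_add_right: "z *\<^sub>C (x + y) = z *\<^sub>C x + z *\<^sub>C y"
    and scaleC_add_left: "(z + w) *\<^sub>C x = z *\<^sub>C x + w *\<^sub>C x"
    and scaleC_scaleC: "z *\<^sub>C w *\<^sub>C x = (z * w) *\<^sub>C x"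
    and cinner_commute: "cinner x y = cnj (cinner y x)"
    and cinner_add_right: "cinner x (y + y') = cinner x y + cinner x y'"
    and cinner_scaleC_right: "cinner x (z *\<^sub>C y) = z * cinner x y"
    and cinner_self: "cinner x x = complex_of_real ((norm x)\<^sup>2)"

lemma norm_scaleC: "norm (z *\<^sub>C x) = cmod z * norm (x :: 'h::chilbert_space)"
proof -
  have "complex_of_real ((norm (z *\<^sub>C x))\<^sup>2) = cinner (z *\<^sub>C x) (z *\<^sub>C x)"
    by (simp only: cinner_self)
  also have "\<dots> = z * cnj (cinner x (z *\<^sub>C x))"
    by (metis cinner_commute cinner_scaleC_right)
  also have "\<dots> = z * cnj z * cnj (cinner x x)"
    by (simp add: cinner_scaleC_right)
  also have "\<dots> = complex_of_real ((cmod z * norm x)\<^sup>2)"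
    by (simp add: cinner_self complex_mult_cnj cmod_power2 power_mult_distrib)
  finally have "(norm (z *\<^sub>C x))\<^sup>2 = (cmod z * norm x)\<^sup>2"
    using of_real_eq_iff by blast
  then show ?thesis
    by (rule power2_eq_imp_eq) auto
qed

lemma bounded_linear_scaleC: "bounded_linear (\<lambda>x :: 'h::chilbert_space. z *\<^sub>C x)"
proof (rule bounded_linear_intro)
  show "z *\<^sub>C (r *\<^sub>R x) = r *\<^sub>R (z *\<^sub>C x)" for r and x :: 'h
    by (simp add: scaleC_of_real[symmetric] scaleC_scaleC mult.commute)
  show "norm (z *\<^sub>C x) \<le> norm x * cmod z" for x :: 'h
    by (simp add: norm_scaleC)
qed (rule scaleC_add_right)

text \<open>The library type \<open>'h \<Rightarrow>\<^sub>L 'h\<close> consists of the bounded \<^emph>\<open>real\<close>-linear maps and carries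
  the operator norm; \<open>B(H)\<close> is its subset of complex-linear maps.\<close>

type_synonym 'h opr = "'h \<Rightarrow>\<^sub>L 'h"

definition bounded_ops :: "'h::chilbert_space opr set" where
  "bounded_ops = {T. \<forall>z x. blinfun_apply T (z *\<^sub>C x) = z *\<^sub>C blinfun_apply T x}"

definition cscale :: "complex \<Rightarrow> 'h::chilbert_space opr \<Rightarrow> 'h opr" where
  "cscale z T = Blinfun (\<lambda>x. z *\<^sub>C x) o\<^sub>L T"

lemma cscale_apply: "blinfun_apply (cscale z T) x = z *\<^sub>C blinfun_apply T x"
  by (simp add: cscale_def bounded_linear_Blinfun_apply[OF bounded_linear_scaleC])

definition op_power :: "'h::chilbert_space opr \<Rightarrow> nat \<Rightarrow> 'h opr" where
  "op_power T n = (blinfun_compose T ^^ n) id_blinfun"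

text \<open>Only used for complex-linear operators, for which the adjoint exists and is unique.\<close>

definition adj :: "'h::chilbert_space opr \<Rightarrow> 'h opr" where
  "adj T = (THE S. \<forall>x y. cinner (blinfun_apply T x) y = cinner x (blinfun_apply S y))"

definition op_le :: "'h::chilbert_space opr \<Rightarrow> 'h opr \<Rightarrow> bool" where
  "op_le S T \<longleftrightarrow> (\<forall>x. cinner x (blinfun_apply (T - S) x) \<in> \<real>\<^sub>\<ge>\<^sub>0)"


section \<open>Von Neumann algebras with a faithful normal tracial state\<close>

definition commutant :: "'h::chilbert_space opr set \<Rightarrow> 'h opr set" where
  "commutant S = {T \<in> bounded_ops. \<forall>R\<in>S. T o\<^sub>L R = R o\<^sub>L T}"

definition star_subalgebra :: "'h::chilbert_space opr set \<Rightarrow> bool" where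
  "star_subalgebra B \<longleftrightarrow> B \<subseteq> bounded_ops \<and> id_blinfun \<in> B \<and>
     (\<forall>S\<in>B. \<forall>T\<in>B. S + T \<in> B \<and> S o\<^sub>L T \<in> B) \<and>
     (\<forall>z. \<forall>T\<in>B. cscale z T \<in> B) \<and> (\<forall>T\<in>B. adj T \<in> B)"

definition von_neumann_algebra :: "'h::chilbert_space opr set \<Rightarrow> bool" where
  "von_neumann_algebra A \<longleftrightarrow> star_subalgebra A \<and> commutant (commutant A) = A"

definition tracial_state :: "'h::chilbert_space opr set \<Rightarrow> ('h opr \<Rightarrow> complex) \<Rightarrow> bool" where
  "tracial_state A \<tau> \<longleftrightarrow>
     (\<forall>a\<in>A. \<forall>b\<in>A. \<tau> (a + b) = \<tau> a + \<tau> b) \<and>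
     (\<forall>z. \<forall>a\<in>A. \<tau> (cscale z a) = z * \<tau> a) \<and>
     \<tau> id_blinfun = 1 \<and>
     (\<forall>a\<in>A. \<tau> (adj a o\<^sub>L a) \<in> \<real>\<^sub>\<ge>\<^sub>0) \<and>
     (\<forall>a\<in>A. \<forall>b\<in>A. \<tau> (a o\<^sub>L b) = \<tau> (b o\<^sub>L a))"

definition faithful_on :: "'h::chilbert_space opr set \<Rightarrow> ('h opr \<Rightarrow> complex) \<Rightarrow> bool" where
  "faithful_on A \<tau> \<longleftrightarrow> (\<forall>a\<in>A. \<tau> (adj a o\<^sub>L a) = 0 \<longrightarrow> a = 0)"

text \<open>Normality: the state preserves suprema of bounded upward directed sets of self-adjoint
  elements.\<close>

definition normal_on :: "'h::chilbert_space opr set \<Rightarrow> ('h opr \<Rightarrow> complex) \<Rightarrow> bool" where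
  "normal_on A \<tau> \<longleftrightarrow>
     (\<forall>D x. D \<subseteq> {a\<in>A. adj a = a} \<and> D \<noteq> {} \<and>
        (\<forall>a\<in>D. \<forall>b\<in>D. \<exists>d\<in>D. op_le a d \<and> op_le b d) \<and>
        x \<in> A \<and> adj x = x \<and> (\<forall>d\<in>D. op_le d x) \<and>
        (\<forall>y\<in>A. adj y = y \<and> (\<forall>d\<in>D. op_le d y) \<longrightarrow> op_le x y)
        \<longrightarrow> Re (\<tau> x) = (SUP d\<in>D. Re (\<tau> d)))"

definition nc_prob_space :: "'h::chilbert_space opr set \<Rightarrow> ('h opr \<Rightarrow> complex) \<Rightarrow> bool" where
  "nc_prob_space A \<tau> \<longleftrightarrow>
     von_neumann_algebra A \<and> tracial_state A \<tau> \<and> faithful_on A \<tau> \<and> normal_on A \<tau>"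

definition L2_norm_op :: "('h opr \<Rightarrow> complex) \<Rightarrow> 'h::chilbert_space opr \<Rightarrow> real" where
  "L2_norm_op \<tau> a = sqrt (Re (\<tau> (adj a o\<^sub>L a)))"

definition orth_projection :: "'h::chilbert_space opr \<Rightarrow> bool" where
  "orth_projection P \<longleftrightarrow> P \<in> bounded_ops \<and> adj P = P \<and> P o\<^sub>L P = P"

definition compression :: "'h::chilbert_space opr set \<Rightarrow> 'h opr \<Rightarrow> 'h opr set" where
  "compression A P = {P o\<^sub>L a o\<^sub>L P | a. a \<in> A}"

text \<open>Spectrum of \<open>x\<close> in an algebra \<open>B\<close> of operators whose unit \<open>e\<close> need not be the identity
  operator.\<close>

definition spectrum_in :: "'h::chilbert_space opr set \<Rightarrow> 'h opr \<Rightarrow> 'h opr \<Rightarrow> complex set" where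
  "spectrum_in B e x =
     {z. \<not> (\<exists>y\<in>B. (cscale z e - x) o\<^sub>L y = e \<and> y o\<^sub>L (cscale z e - x) = e)}"

definition invertible_in :: "'h::chilbert_space opr set \<Rightarrow> 'h opr \<Rightarrow> bool" where
  "invertible_in A x \<longleftrightarrow> (\<exists>y\<in>A. x o\<^sub>L y = id_blinfun \<and> y o\<^sub>L x = id_blinfun)"

definition op_inverse :: "'h::chilbert_space opr \<Rightarrow> 'h opr" where
  "op_inverse x = (THE y. x o\<^sub>L y = id_blinfun \<and> y o\<^sub>L x = id_blinfun)"


section \<open>Freeness\<close>

text \<open>Freeness of two sets of elements means freeness of the unital \<open>*\<close>-algebras they generate:
  alternating products of centred elements are centred. A list entry carries a flag
  telling from which of the two algebras the factor is taken.\<close>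

definition free_sets ::
  "('h opr \<Rightarrow> complex) \<Rightarrow> 'h::chilbert_space opr set \<Rightarrow> 'h opr set \<Rightarrow> bool" where
  "free_sets \<tau> S T \<longleftrightarrow>
     (\<forall>as :: (bool \<times> 'h opr) list.
        as \<noteq> [] \<and> distinct_adj (map fst as) \<and>
        (\<forall>(i, a) \<in> set as. a \<in> star_subalgebra hull (if i then S else T) \<and> \<tau> a = 0)
        \<longrightarrow> \<tau> (foldr (o\<^sub>L) (map snd as) id_blinfun) = 0)"


section \<open>Free Brownian motions\<close>

text \<open>The semicircle law of variance \<open>v > 0\<close> has density
  \<open>sqrt (4 v - u\<^sup>2) / (2 \<pi> v)\<close> on \<open>[- 2 sqrt v, 2 sqrt v]\<close>; being compactly supported, it is
  determined by its moments.\<close>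

definition semicircular ::
  "('h opr \<Rightarrow> complex) \<Rightarrow> real \<Rightarrow> 'h::chilbert_space opr \<Rightarrow> bool" where
  "semicircular \<tau> v x \<longleftrightarrow> adj x = x \<and>
     (\<forall>n. \<tau> (op_power x n) = complex_of_real
        (integral {- 2 * sqrt v .. 2 * sqrt v} (\<lambda>u. u ^ n * (sqrt (4 * v - u\<^sup>2) / (2 * pi * v)))))"

text \<open>All processes are indexed by \<open>{0..}\<close>; their values at negative times are irrelevant.\<close>

definition free_brownian_motion ::
  "'h::chilbert_space opr set \<Rightarrow> ('h opr \<Rightarrow> complex) \<Rightarrow> (real \<Rightarrow> 'h opr) \<Rightarrow> bool" where
  "free_brownian_motion A \<tau> x \<longleftrightarrow>
     (\<forall>t\<ge>0. x t \<in> A \<and> adj (x t) = x t) \<and> x 0 = 0 \<and>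
     (\<forall>s t. 0 \<le> s \<and> s < t \<longrightarrow>
        semicircular \<tau> (t - s) (x t - x s) \<and> free_sets \<tau> {x t - x s} (x ` {0..s}))"

text \<open>The factor \<open>1 / sqrt 2\<close> yields the normalization \<open>\<tau> (c t (c t)\<^sup>*) = t\<close>.\<close>

definition free_circular_brownian_motion ::
  "'h::chilbert_space opr set \<Rightarrow> ('h opr \<Rightarrow> complex) \<Rightarrow> (real \<Rightarrow> 'h opr) \<Rightarrow> bool" where
  "free_circular_brownian_motion A \<tau> c \<longleftrightarrow>
     (\<exists>x y. free_brownian_motion A \<tau> x \<and> free_brownian_motion A \<tau> y \<and>
        free_sets \<tau> (x ` {0..}) (y ` {0..}) \<and>
        (\<forall>t\<ge>0. c t = cscale (complex_of_real (1 / sqrt 2)) (x t + cscale \<i> (y t))))"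

text \<open>Natural filtration: the von Neumann algebra generated by the past of \<open>c\<close>.\<close>

definition filtration :: "(real \<Rightarrow> 'h opr) \<Rightarrow> real \<Rightarrow> 'h::chilbert_space opr set" where
  "filtration c t = von_neumann_algebra hull (c ` {0..t})"

text \<open>A simple adapted process on \<open>[0, t)\<close> takes the value \<open>u i\<close>, measurable at time \<open>s i\<close>,
  on the interval \<open>[s i, s (i + 1))\<close>, where \<open>0 = s 0 < \<dots> < s n = t\<close>.\<close>

definition simple_adapted ::
  "(real \<Rightarrow> 'h opr) \<Rightarrow> real \<Rightarrow> nat \<Rightarrow> (nat \<Rightarrow> real) \<Rightarrow> (nat \<Rightarrow> 'h::chilbert_space opr) \<Rightarrow> bool" where
  "simple_adapted c t n s u \<longleftrightarrow> s 0 = 0 \<and> s n = t \<and>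
     (\<forall>i<n. s i < s (Suc i) \<and> u i \<in> filtration c (s i))"

definition simple_value ::
  "nat \<Rightarrow> (nat \<Rightarrow> real) \<Rightarrow> (nat \<Rightarrow> 'h::chilbert_space opr) \<Rightarrow> real \<Rightarrow> 'h opr" where
  "simple_value n s u r = (\<Sum>i<n. indicator {s i..<s (Suc i)} r *\<^sub>R u i)"

definition simple_integral ::
  "(real \<Rightarrow> 'h opr) \<Rightarrow> nat \<Rightarrow> (nat \<Rightarrow> real) \<Rightarrow> (nat \<Rightarrow> 'h::chilbert_space opr) \<Rightarrow> 'h opr" where
  "simple_integral c n s u = (\<Sum>i<n. u i o\<^sub>L (c (s (Suc i)) - c (s i)))"

text \<open>\<open>I\<close> is the free Ito integral of \<open>w\<close> against \<open>dc\<close> over \<open>[0, t]\<close>: there are simple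
  adapted processes approximating \<open>w\<close> in \<open>L\<^sup>2([0, t]; L\<^sup>2(\<tau>))\<close> whose elementary integrals converge
  to \<open>I\<close> in \<open>L\<^sup>2(\<tau>)\<close>. By the Ito isometry \<open>I\<close> does not depend on their choice.\<close>

definition has_free_integral ::
  "('h opr \<Rightarrow> complex) \<Rightarrow> (real \<Rightarrow> 'h opr) \<Rightarrow> (real \<Rightarrow> 'h opr) \<Rightarrow> real \<Rightarrow> 'h::chilbert_space opr
    \<Rightarrow> bool" where
  "has_free_integral \<tau> c w t I \<longleftrightarrow>
     (\<exists>n s u d. (\<forall>m. simple_adapted c t (n m) (s m) (u m)) \<and>
        (\<forall>m. ((\<lambda>r. (L2_norm_op \<tau> (w r - simple_value (n m) (s m) (u m) r))\<^sup>2)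
               has_integral d m) {0..t}) \<and>
        d \<longlonglongrightarrow> 0 \<and>
        (\<lambda>m. L2_norm_op \<tau> (I - simple_integral c (n m) (s m) (u m))) \<longlonglongrightarrow> 0)"

text \<open>Solutions of \<open>dg\<^sub>t = g\<^sub>t dc\<^sub>t\<close>, \<open>g\<^sub>0 = 1\<close>: norm continuous adapted processes satisfying the
  integrated equation.\<close>

definition free_multiplicative_brownian_motion ::
  "('h opr \<Rightarrow> complex) \<Rightarrow> (real \<Rightarrow> 'h opr) \<Rightarrow> (real \<Rightarrow> 'h::chilbert_space opr) \<Rightarrow> bool" where
  "free_multiplicative_brownian_motion \<tau> c g \<longleftrightarrow>
     (\<forall>t\<ge>0. g t \<in> filtration c t) \<and> continuous_on {0..} g \<and> g 0 = id_blinfun \<and>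
     (\<forall>t\<ge>0. has_free_integral \<tau> c g t (g t - id_blinfun))"

definition free_positive_brownian_motion ::
  "(real \<Rightarrow> 'h::chilbert_space opr) \<Rightarrow> real \<Rightarrow> 'h opr" where
  "free_positive_brownian_motion g t = g t o\<^sub>L adj (g t)"

definition free_jacobi ::
  "'h::chilbert_space opr \<Rightarrow> (real \<Rightarrow> 'h opr) \<Rightarrow> real \<Rightarrow> 'h opr" where
  "free_jacobi P h t = P o\<^sub>L h t o\<^sub>L P o\<^sub>L op_inverse (h t) o\<^sub>L P"

end

theory Submission
  imports Defs
begin

text \<open>Let \<open>x = P h P\<close> and \<open>y = P h\<inverse> P\<close>, so that \<open>j = x y\<close>. Since \<open>h = g g\<^sup>*\<close> is positive and
  invertible, \<open>y\<close> is bounded below on the range of \<open>P\<close> and \<open>y \<le> y x y\<close>. For a unit vector \<open>v\<close> in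
  that range put \<open>a = \<langle>v, y v\<rangle>\<close> and \<open>b = \<langle>v, y x y v\<rangle>\<close>. Then \<open>0 < a \<le> b\<close>, so
  \<open>\<bar>\<langle>v, y (z - j) v\<rangle>\<bar> = \<bar>z a - b\<bar> = a \<bar>z - b / a\<bar>\<close> is at least \<open>a\<close> times the distance of \<open>z\<close> from
  \<open>[1, \<infinity>)\<close>. For \<open>z\<close> outside this ray, Lax--Milgram inverts \<open>y (z - j)\<close> and \<open>y\<close> in the corner, hence
  \<open>z - j\<close>.\<close>

section \<open>Geometry of complex Hilbert spaces\<close>

lemma cinner_add_left: "cinner (x + x') (y :: 'h::chilbert_space) = cinner x y + cinner x' y"
  by (metis cinner_add_right cinner_commute complex_cnj_add)

lemma cinner_scaleC_left: "cinner (z *\<^sub>C x) (y :: 'h::chilbert_space) = cnj z * cinner x y"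
  by (metis cinner_commute cinner_scaleC_right complex_cnj_mult)

lemma scaleC_minus1: "(-1) *\<^sub>C x = - (x :: 'h::chilbert_space)"
  using scaleC_of_real[of "-1" x] by simp

lemma scaleC_zero_left [simp]: "0 *\<^sub>C x = (0 :: 'h::chilbert_space)"
  using scaleC_of_real[of 0 x] by simp

lemma scaleC_one [simp]: "1 *\<^sub>C x = (x :: 'h::chilbert_space)"
  using scaleC_of_real[of 1 x] by simp

lemma scaleC_zero_right [simp]: "z *\<^sub>C 0 = (0 :: 'h::chilbert_space)"
  by (metis mult_zero_right scaleC_scaleC scaleC_zero_left)

lemma cinner_minus_right: "cinner x (- y) = - cinner x (y :: 'h::chilbert_space)"
  using cinner_scaleC_right[of x "-1" y] by (simp add: scaleC_minus1)

lemma cinner_minus_left: "cinner (- x) y = - cinner x (y :: 'h::chilbert_space)"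
  using cinner_scaleC_left[of "-1" x y] by (simp add: scaleC_minus1)

lemma cinner_diff_right: "cinner x (y - z) = cinner x y - cinner x (z :: 'h::chilbert_space)"
  using cinner_add_right[of x y "-z"] by (simp add: cinner_minus_right)

lemma cinner_diff_left: "cinner (x - y) z = cinner x z - cinner y (z :: 'h::chilbert_space)"
  using cinner_add_left[of x "-y" z] by (simp add: cinner_minus_left)

lemma cinner_zero_right [simp]: "cinner x (0 :: 'h::chilbert_space) = 0"
  using cinner_scaleC_right[of x 0 x] by simp

lemma cinner_zero_left [simp]: "cinner 0 (x :: 'h::chilbert_space) = 0"
  using cinner_scaleC_left[of 0 x x] by simp

lemmas cinner_simps = cinner_add_left cinner_add_right cinner_diff_left cinner_diff_right
  cinner_scaleC_left cinner_scaleC_right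

lemma cinner_ext:
  assumes "\<And>x. cinner x y = cinner x (z :: 'h::chilbert_space)"
  shows "y = z"
proof -
  have "cinner (y - z) (y - z) = 0"
    using assms by (simp add: cinner_diff_right)
  then show ?thesis
    by (simp add: cinner_self)
qed

text \<open>Pythagoras for the residual of \<open>x\<close> after projection onto the line through
  \<open>y\<close>. Nonnegativity of the left side gives Cauchy-Schwarz; the exact decrease on the
  right shows below that a nearest point has an orthogonal residual.\<close>

lemma norm_projection_residual:
  fixes x y :: "'h::chilbert_space"
  assumes "y \<noteq> 0"
  shows "(norm (x - (cinner y x / (norm y)\<^sup>2) *\<^sub>C y))\<^sup>2
       = (norm x)\<^sup>2 - (cmod (cinner y x))\<^sup>2 / (norm y)\<^sup>2"
proof -
  define r where "r = complex_of_real ((norm y)\<^sup>2)"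
  let ?k = "cinner y x"
  have r: "r \<noteq> 0" using assms by (simp add: r_def)
  have k: "cinner x y = cnj ?k" by (rule cinner_commute)
  have kk: "?k * cnj ?k = complex_of_real ((cmod ?k)\<^sup>2)"
    by (rule complex_norm_square[symmetric])
  have "complex_of_real ((norm (x - (?k / r) *\<^sub>C y))\<^sup>2)
      = cinner (x - (?k / r) *\<^sub>C y) (x - (?k / r) *\<^sub>C y)"
    by (simp only: cinner_self)
  also have "\<dots> = cinner x x - ?k / r * cnj ?k - cnj ?k / r * ?k
      + cnj ?k / r * (?k / r) * r"
    using cinner_self[of y] k unfolding r_def[symmetric] by (simp add: cinner_simps algebra_simps)
  also have "\<dots> = cinner x x - (?k * cnj ?k) / r"
    using r by (simp add: field_simps)
  also have "\<dots> = complex_of_real ((norm x)\<^sup>2 - (cmod ?k)\<^sup>2 / (norm y)\<^sup>2)"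
    by (simp only: kk cinner_self of_real_diff of_real_divide r_def)
  finally show ?thesis
    unfolding r_def using of_real_eq_iff by (metis of_real_power)
qed

lemma cinner_Cauchy_Schwarz: "cmod (cinner y x) \<le> norm y * norm (x :: 'h::chilbert_space)"
proof (cases "y = 0")
  case False
  have "0 \<le> (norm x)\<^sup>2 - (cmod (cinner y x))\<^sup>2 / (norm y)\<^sup>2"
    using norm_projection_residual[OF False, of x] by (metis zero_le_power2)
  then have "(cmod (cinner y x))\<^sup>2 \<le> (norm y * norm x)\<^sup>2"
    using False by (simp add: field_simps power_mult_distrib)
  then show ?thesis
    by (rule power2_le_imp_le) simp
qed simp

lemma parallelogram_law:
  "(norm (x + y))\<^sup>2 + (norm (x - y))\<^sup>2 = 2 * (norm x)\<^sup>2 + 2 * (norm (y :: 'h::chilbert_space))\<^sup>2"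
proof -
  have "complex_of_real ((norm (x + y))\<^sup>2 + (norm (x - y))\<^sup>2)
      = complex_of_real (2 * (norm x)\<^sup>2 + 2 * (norm y)\<^sup>2)"
    by (simp only: of_real_add of_real_mult cinner_self[symmetric]) (simp add: cinner_simps)
  then show ?thesis
    using of_real_eq_iff by blast
qed

section \<open>Nearest points, orthogonal vectors and the Riesz representation\<close>

definition csubspace :: "'h::chilbert_space set \<Rightarrow> bool" where
  "csubspace M \<longleftrightarrow> 0 \<in> M \<and> (\<forall>x\<in>M. \<forall>y\<in>M. x + y \<in> M) \<and> (\<forall>z. \<forall>x\<in>M. z *\<^sub>C x \<in> M)"

text \<open>A minimizing sequence is Cauchy by the parallelogram law, hence converges by
  completeness, and its limit stays in the closed set \<open>M\<close>.\<close>

lemma nearest_point_exists: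
  fixes M :: "'h::chilbert_space set"
  assumes "closed M" "csubspace M"
  obtains m where "m \<in> M" "\<And>m'. m' \<in> M \<Longrightarrow> norm (x - m) \<le> norm (x - m')"
proof -
  have M0: "0 \<in> M" and M1: "\<And>x y. x \<in> M \<Longrightarrow> y \<in> M \<Longrightarrow> x + y \<in> M"
    and M2: "\<And>z x. x \<in> M \<Longrightarrow> z *\<^sub>C x \<in> M"
    using assms(2) by (auto simp: csubspace_def)
  define d where "d = infdist x M"
  have d0: "d \<ge> 0" by (simp add: d_def infdist_nonneg)
  have dle: "d \<le> norm (x - m)" if "m \<in> M" for m
    using infdist_le[OF that, of x] by (simp add: d_def dist_norm)
  have "\<exists>m\<in>M. norm (x - m) < d + inverse (Suc n)" for n
  proof (rule ccontr)
    assume "\<not> ?thesis"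
    then have "d + inverse (Suc n) \<le> (INF m\<in>M. dist x m)"
      using M0 by (intro cINF_greatest) (auto simp: dist_norm not_less)
    then show False
      using M0 unfolding d_def infdist_def by (auto split: if_splits)
  qed
  then obtain m where m: "\<And>n. m n \<in> M" "\<And>n. norm (x - m n) < d + inverse (Suc n)"
    by metis
  have lim: "(\<lambda>n. norm (x - m n)) \<longlonglongrightarrow> d"
  proof (rule tendsto_sandwich[OF _ _ tendsto_const])
    show "(\<lambda>n. d + inverse (Suc n)) \<longlonglongrightarrow> d"
      using tendsto_add[OF tendsto_const LIMSEQ_inverse_real_of_nat, of d] by simp
  qed (simp_all only: dle m less_imp_le always_eventually simp_thms)
  have diam: "(norm (m i - m j))\<^sup>2 \<le> 2 * ((norm (x - m i))\<^sup>2 - d\<^sup>2) + 2 * ((norm (x - m j))\<^sup>2 - d\<^sup>2)"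
    for i j
  proof -
    \<comment> \<open>The midpoint of \<open>m i\<close> and \<open>m j\<close> lies in
      \<open>M\<close>, so its distance from \<open>x\<close> is at least \<open>d\<close>. This
      bounds the sum term of the parallelogram law from below, hence the difference term from
      above.\<close>
    have "complex_of_real (1/2) *\<^sub>C (m i + m j) \<in> M"
      by (intro M1 M2 m)
    then have "d \<le> norm (x - (1/2) *\<^sub>R (m i + m j))"
      unfolding scaleC_of_real by (rule dle)
    also have "\<dots> = norm ((1/2) *\<^sub>R ((x - m i) + (x - m j)))"
      by (rule arg_cong[of _ _ norm]) (simp add: algebra_simps flip: scaleR_left.add)
    finally have "2 * d \<le> norm ((x - m i) + (x - m j))"
      by simp
    then have "(2 * d)\<^sup>2 \<le> (norm ((x - m i) + (x - m j)))\<^sup>2"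
      using d0 by (intro power_mono) auto
    moreover have "norm ((x - m i) - (x - m j)) = norm (m i - m j)"
      by (simp add: norm_minus_commute)
    ultimately show ?thesis
      using parallelogram_law[of "x - m i" "x - m j"] by (simp add: power_mult_distrib)
  qed
  have "Cauchy m"
  proof (rule CauchyI)
    fix e :: real assume e: "0 < e"
    have "(\<lambda>n. (norm (x - m n))\<^sup>2 - d\<^sup>2) \<longlonglongrightarrow> d\<^sup>2 - d\<^sup>2"
      by (intro tendsto_intros lim)
    \<comment> \<open>With the threshold \<open>e\<^sup>2 / 4\<close>, the two terms of
      \<open>diam\<close>, each carrying a factor 2, add up to less than
      \<open>e\<^sup>2\<close>.\<close>
    then have "\<forall>\<^sub>F n in sequentially. (norm (x - m n))\<^sup>2 - d\<^sup>2 < e\<^sup>2 / 4"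
      using e by (intro order_tendstoD(2)) auto
    then obtain N where N: "\<And>n. n \<ge> N \<Longrightarrow> (norm (x - m n))\<^sup>2 - d\<^sup>2 < e\<^sup>2 / 4"
      by (auto simp: eventually_sequentially)
    have "norm (m i - m j) < e" if "i \<ge> N" "j \<ge> N" for i j
    proof (rule power2_less_imp_less)
      show "(norm (m i - m j))\<^sup>2 < e\<^sup>2"
        using diam[of i j] N[OF that(1)] N[OF that(2)] by argo
    qed (use e in simp)
    then show "\<exists>N. \<forall>i\<ge>N. \<forall>j\<ge>N. norm (m i - m j) < e"
      by blast
  qed
  then obtain l where l: "m \<longlonglongrightarrow> l"
    using Cauchy_convergent convergentD by blast
  have "l \<in> M"
    using closed_sequentially[OF assms(1)] m(1) l by blast
  moreover have "norm (x - l) = d"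
    by (rule LIMSEQ_unique[OF tendsto_norm[OF tendsto_diff[OF tendsto_const l]] lim])
  ultimately show thesis
    using that dle by metis
qed

text \<open>The vector is the residual of \<open>x\<close> at its nearest point in \<open>M\<close>.
  If some \<open>y\<close> in \<open>M\<close> were not orthogonal to it, adding the projection of
  the residual onto \<open>y\<close> to the nearest point would bring it closer to
  \<open>x\<close>.\<close>

lemma orthogonal_vector_exists:
  fixes M :: "'h::chilbert_space set"
  assumes "closed M" "csubspace M" "x \<notin> M"
  obtains w where "w \<noteq> 0" "\<And>m. m \<in> M \<Longrightarrow> cinner m w = 0"
proof -
  obtain m where m: "m \<in> M" and min: "\<And>m'. m' \<in> M \<Longrightarrow> norm (x - m) \<le> norm (x - m')"
    using nearest_point_exists[OF assms(1,2)] by metis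
  have "cinner y (x - m) = 0" if "y \<in> M" for y
  proof (cases "y = 0")
    case False
    let ?k = "cinner y (x - m) / (norm y)\<^sup>2"
    have "m + ?k *\<^sub>C y \<in> M"
      using assms(2) that m by (auto simp: csubspace_def)
    then have "norm (x - m) \<le> norm (x - m - ?k *\<^sub>C y)"
      using min by (metis diff_diff_eq)
    then have "(norm (x - m))\<^sup>2 \<le> (norm (x - m - ?k *\<^sub>C y))\<^sup>2"
      by (rule power_mono) simp
    then have "(cmod (cinner y (x - m)))\<^sup>2 / (norm y)\<^sup>2 \<le> 0"
      using norm_projection_residual[OF False, of "x - m"] by linarith
    then show ?thesis
      using False by (simp add: divide_le_0_iff)
  qed simp
  moreover have "x - m \<noteq> 0"
    using assms(3) m by auto
  ultimately show thesis
    using that by blast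
qed

lemma Riesz_representation:
  fixes f :: "'h::chilbert_space \<Rightarrow> complex"
  assumes "bounded_linear f" and f: "\<And>z x. f (z *\<^sub>C x) = z * f x"
  obtains u where "\<And>x. f x = cinner u x"
proof (cases "\<forall>x. f x = 0")
  case True
  then show thesis
    using that[of 0] by simp
next
  case False
  interpret f: bounded_linear f by fact
  let ?M = "{x. f x = 0}"
  have "closed ?M"
    by (intro closed_Collect_eq f.continuous_on continuous_intros)
  moreover have "csubspace ?M"
    by (auto simp: csubspace_def f f.add f.zero)
  moreover obtain x where "x \<notin> ?M"
    using False by auto
  ultimately obtain w where w: "w \<noteq> 0" "\<And>m. f m = 0 \<Longrightarrow> cinner m w = 0"
    by (metis (mono_tags, lifting) mem_Collect_eq orthogonal_vector_exists)
  have "f x = cinner ((cnj (f w) / (norm w)\<^sup>2) *\<^sub>C w) x" for x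
  proof -
    \<comment> \<open>This combination lies in the kernel, so it is orthogonal to \<open>w\<close>;
      solving that orthogonality relation for \<open>f x\<close> yields the representing
      vector.\<close>
    have "f (f w *\<^sub>C x - f x *\<^sub>C w) = 0"
      by (simp add: f f.diff)
    then have "cinner w (f w *\<^sub>C x - f x *\<^sub>C w) = 0"
      using w(2) by (metis cinner_commute complex_cnj_zero)
    then have "f w * cinner w x = f x * (norm w)\<^sup>2"
      by (simp add: cinner_simps cinner_self)
    then show ?thesis
      using w(1) by (simp add: cinner_simps field_simps)
  qed
  then show thesis
    by (rule that)
qed

section \<open>Bounded complex-linear operators\<close>

lemma blinfun_compose_assoc: "(R o\<^sub>L S) o\<^sub>L T = R o\<^sub>L (S o\<^sub>L T)"
  by (rule blinfun_eqI) simp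

lemma bounded_linear_cinner_right:
  "bounded_linear (\<lambda>y :: 'h::chilbert_space. cinner x y)"
proof (rule bounded_linear_intro)
  show "cinner x (r *\<^sub>R y) = r *\<^sub>R cinner x y" for r y
    by (metis cinner_scaleC_right scaleC_of_real scaleR_conv_of_real)
  show "norm (cinner x y) \<le> norm y * norm x" for y
    using cinner_Cauchy_Schwarz[of x y] by (simp add: mult.commute)
qed (rule cinner_add_right)

text \<open>Riesz applied to the functional \<langle>y, T x\<rangle> of \<open>x\<close> gives
  \<open>S y\<close>. Boundedness follows by taking \<open>x = S y\<close> in the adjoint relation
  and applying Cauchy-Schwarz.\<close>

lemma adjoint_exists:
  fixes T :: "'h::chilbert_space opr"
  assumes "T \<in> bounded_ops"
  obtains S :: "'h opr" where "\<And>x y. cinner (T x) y = cinner x (S y)"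
proof -
  have "\<exists>u. \<forall>x. cinner y (T x) = cinner u x" for y
  proof -
    have "bounded_linear (\<lambda>x. cinner y (T x))"
      by (intro bounded_linear_compose[OF bounded_linear_cinner_right] blinfun.bounded_linear_right)
    moreover have "cinner y (T (z *\<^sub>C x)) = z * cinner y (T x)" for z x
      using assms by (simp add: bounded_ops_def cinner_simps)
    ultimately show ?thesis
      by (metis Riesz_representation)
  qed
  then obtain S where "\<And>y x. cinner y (T x) = cinner (S y) x"
    by metis
  then have S: "cinner (T x) y = cinner x (S y)" for x y
    by (metis cinner_commute)
  have "bounded_linear S"
  proof (rule bounded_linear_intro)
    show "S (x + y) = S x + S y" for x y
      by (rule cinner_ext) (simp add: cinner_simps flip: S)
    show "S (r *\<^sub>R x) = r *\<^sub>R S x" for r x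
      by (rule cinner_ext) (simp add: cinner_simps flip: S scaleC_of_real)
    show "norm (S y) \<le> norm y * norm T" for y
    proof (cases "S y = 0")
      case False
      have "complex_of_real ((norm (S y))\<^sup>2) = cinner (T (S y)) y"
        by (simp add: S cinner_self)
      then have "(norm (S y))\<^sup>2 = cmod (cinner (T (S y)) y)"
        by (metis abs_of_nonneg norm_of_real zero_le_power2)
      also have "\<dots> \<le> norm (T (S y)) * norm y"
        by (rule cinner_Cauchy_Schwarz)
      also have "\<dots> \<le> norm T * norm (S y) * norm y"
        by (intro mult_right_mono norm_blinfun) simp
      finally show ?thesis
        using False by (simp add: power2_eq_square mult.commute mult.left_commute)
    qed simp
  qed
  then have "cinner (T x) y = cinner x (Blinfun S y)" for x y
    by (simp add: S bounded_linear_Blinfun_apply)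
  then show thesis
    by (rule that)
qed

text \<open>Existence by Riesz and uniqueness by \<open>cinner_ext\<close> justify the definite
  description in \<open>adj\<close>.\<close>

lemma cinner_adj:
  fixes T :: "'h::chilbert_space opr"
  assumes "T \<in> bounded_ops"
  shows "cinner (T x) y = cinner x (adj T y)"
proof -
  obtain S :: "'h opr" where S: "\<And>x y. cinner (T x) y = cinner x (S y)"
    using adjoint_exists[OF assms] by blast
  have "adj T = S"
    unfolding adj_def
  proof (rule the_equality)
    show "\<forall>x y. cinner (T x) y = cinner x (S y)"
      using S by blast
    show "S' = S" if "\<forall>x y. cinner (T x) y = cinner x (S' y)" for S' :: "'h opr"
    proof (intro blinfun_eqI cinner_ext)
      show "cinner x (S' y) = cinner x (S y)" for x y
        using that S by metis
    qed
  qed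
  then show ?thesis
    by (simp add: S)
qed

lemma csubspace_range:
  assumes "T \<in> bounded_ops"
  shows "csubspace (range (blinfun_apply T))"
proof -
  have "T x + T y = T (x + y)" "z *\<^sub>C T x = T (z *\<^sub>C x)" "T 0 = 0" for x y z
    using assms by (auto simp: blinfun.add_right blinfun.zero_right bounded_ops_def)
  then show ?thesis
    unfolding csubspace_def by (metis (no_types, lifting) rangeE rangeI)
qed

text \<open>The lower bound gives injectivity and a complete, hence closed, range. A closed proper
  subspace has a nonzero orthogonal vector, which \<open>dense\<close> excludes, so the range is
  everything.\<close>

lemma invertible_if_bounded_below:
  fixes T :: "'h::chilbert_space opr"
  assumes T: "T \<in> bounded_ops" and "e > 0" and below: "\<And>v. e * norm v \<le> norm (T v)"
    and dense: "\<And>w. (\<And>v. cinner (T v) w = 0) \<Longrightarrow> w = 0"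
  obtains S where "S \<in> bounded_ops" "T o\<^sub>L S = id_blinfun" "S o\<^sub>L T = id_blinfun"
proof -
  have "complete (range (blinfun_apply T))"
    using complete_isometric_image[OF \<open>e > 0\<close> subspace_UNIV blinfun.bounded_linear_right, of T]
      below by (simp add: complete_UNIV mult.commute)
  then have "range (blinfun_apply T) = UNIV"
    using orthogonal_vector_exists[OF complete_imp_closed csubspace_range[OF T]] dense
    by (metis UNIV_eq_I rangeI)
  moreover have "inj (blinfun_apply T)"
  proof (rule injI)
    fix x y assume "T x = T y"
    then show "x = y"
      using below[of "x - y"] \<open>e > 0\<close> by (simp add: blinfun.diff_right mult_le_0_iff)
  qed
  ultimately have TS: "T (inv T x) = x" and ST: "inv T (T x) = x" for x
    by (simp_all add: surj_f_inv_f)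
  have bl: "bounded_linear (inv T)"
  proof (rule bounded_linear_intro)
    show "inv T (x + y) = inv T x + inv T y" for x y
      by (metis TS ST blinfun.add_right)
    show "inv T (r *\<^sub>R x) = r *\<^sub>R inv T x" for r x
      by (metis TS ST blinfun.scaleR_right)
    show "norm (inv T x) \<le> norm x * inverse e" for x
      using below[of "inv T x"] \<open>e > 0\<close> by (simp add: TS field_simps)
  qed
  show thesis
  proof
    show "Blinfun (inv T) \<in> bounded_ops"
      using T by (auto simp: bounded_ops_def bounded_linear_Blinfun_apply[OF bl]) (metis TS ST)
    show "T o\<^sub>L Blinfun (inv T) = id_blinfun" "Blinfun (inv T) o\<^sub>L T = id_blinfun"
      by (auto intro!: blinfun_eqI simp: bounded_linear_Blinfun_apply[OF bl] TS ST)
  qed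
qed

section \<open>Invertibility in a corner of a von Neumann algebra\<close>

lemma star_subalgebra_diff:
  assumes "star_subalgebra A" "S \<in> A" "T \<in> A"
  shows "S - T \<in> A"
proof -
  have "cscale (-1) T = - T"
    by (rule blinfun_eqI) (simp add: cscale_apply blinfun.minus_left scaleC_minus1)
  then have "S - T = S + cscale (-1) T"
    by simp
  then show ?thesis
    using assms unfolding star_subalgebra_def by metis
qed

text \<open>An inverse commutes with whatever commutes with \<open>T\<close>, so it belongs to the
  bicommutant.\<close>

lemma von_neumann_algebra_inverse:
  assumes A: "von_neumann_algebra A" and T: "T \<in> A" and S: "S \<in> bounded_ops"
    and TS: "T o\<^sub>L S = id_blinfun" and ST: "S o\<^sub>L T = id_blinfun"
  shows "S \<in> A"
proof -
  have "S o\<^sub>L R = R o\<^sub>L S" if "R \<in> commutant A" for R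
  proof (rule blinfun_eqI)
    fix v
    have "R (T (S v)) = T (R (S v))"
      using that T by (metis (mono_tags, lifting) blinfun_apply_blinfun_compose commutant_def
          mem_Collect_eq)
    then show "(S o\<^sub>L R) v = (R o\<^sub>L S) v"
      by (metis TS ST blinfun_apply_blinfun_compose blinfun_apply_id_blinfun)
  qed
  then have "S \<in> commutant (commutant A)"
    using S by (auto simp: commutant_def)
  then show ?thesis
    using A by (simp add: von_neumann_algebra_def)
qed

lemma cinner_orth_projection:
  assumes "orth_projection P"
  shows "cinner (P x) y = cinner x (P y)"
  using cinner_adj[of P x y] assms by (simp add: orth_projection_def)

lemma orth_projection_idem:
  assumes "orth_projection P"
  shows "P (P x) = P x"
  using assms by (metis blinfun_apply_blinfun_compose orth_projection_def)

lemma norm_orth_projection_le: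
  assumes "orth_projection P"
  shows "norm (P x) \<le> norm x"
proof (cases "P x = 0")
  case False
  have "cinner (P x) x = cinner (P x) (P x)"
    by (metis assms cinner_orth_projection orth_projection_idem)
  then have "(norm (P x))\<^sup>2 = cmod (cinner (P x) x)"
    by (simp add: cinner_self norm_power)
  also have "\<dots> \<le> norm (P x) * norm x"
    by (rule cinner_Cauchy_Schwarz)
  finally show ?thesis
    using False by (simp add: power2_eq_square)
qed simp

text \<open>Lax--Milgram in the corner: \<open>Z + (1 - P)\<close> is invertible on the whole space, and its inverse
  lies in the algebra by the bicommutant property.\<close>

lemma corner_invertible:
  fixes A :: "'h::chilbert_space opr set"
  assumes A: "von_neumann_algebra A" and P: "P \<in> A" "orth_projection P"
    and Z: "Z \<in> A" "P o\<^sub>L Z = Z" "Z o\<^sub>L P = Z"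
    and "e > 0" and coercive: "\<And>v. P v = v \<Longrightarrow> e * (norm v)\<^sup>2 \<le> cmod (cinner v (Z v))"
  obtains S where "S \<in> compression A P" "Z o\<^sub>L S = P" "S o\<^sub>L Z = P"
proof -
  have star: "star_subalgebra A" and AB: "A \<subseteq> bounded_ops" and idA: "id_blinfun \<in> A"
    and Aadd: "\<And>S T. S \<in> A \<Longrightarrow> T \<in> A \<Longrightarrow> S + T \<in> A"
    using A by (auto simp: von_neumann_algebra_def star_subalgebra_def)
  define T where "T = Z + (id_blinfun - P)"
  have TA: "T \<in> A"
    unfolding T_def by (intro Aadd Z star_subalgebra_diff[OF star] P idA)
  have Tv: "T v = Z v + (v - P v)" for v
    by (simp add: T_def blinfun.add_left blinfun.diff_left)
  have PP: "P (P v) = P v" and PZ: "P (Z v) = Z v" and ZP: "Z (P v) = Z v" for v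
    using Z by (metis blinfun_apply_blinfun_compose orth_projection_idem[OF P(2)])+
  have PT: "P (T v) = Z v" for v
    by (simp add: Tv blinfun.add_right blinfun.diff_right PP PZ)
  have TP: "T (P v) = Z v" for v
    by (simp add: Tv PP ZP)
  have Zbelow: "e * norm (P v) \<le> norm (Z v)" for v
  proof (cases "P v = 0")
    case False
    have "e * (norm (P v))\<^sup>2 \<le> norm (P v) * norm (Z (P v))"
      using coercive[OF PP] cinner_Cauchy_Schwarz by (rule order_trans)
    then show ?thesis
      using False by (simp add: ZP power2_eq_square)
  qed simp
  \<comment> \<open>Split \<open>v\<close> as \<open>P v + (v - P v)\<close>. In terms of the norm
    of \<open>T v\<close>, the first part costs \<open>inverse e\<close> by coercivity, the second
    costs 2 because \<open>P\<close> is a contraction.\<close>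
  have below: "inverse (inverse e + 2) * norm v \<le> norm (T v)" for v
  proof -
    have "norm (P v) \<le> inverse e * norm (P (T v))"
      using Zbelow[of v] \<open>e > 0\<close> by (simp add: PT field_simps)
    also have "\<dots> \<le> inverse e * norm (T v)"
      using \<open>e > 0\<close> by (intro mult_left_mono norm_orth_projection_le P) auto
    finally have 1: "norm (P v) \<le> inverse e * norm (T v)" .
    have "v - P v = T v - P (T v)"
      by (simp only: PT) (simp add: Tv)
    then have "norm (v - P v) \<le> norm (T v) + norm (P (T v))"
      by (simp add: norm_triangle_ineq4)
    also have "\<dots> \<le> 2 * norm (T v)"
      using norm_orth_projection_le[OF P(2), of "T v"] by simp
    finally have "norm v \<le> (inverse e + 2) * norm (T v)"
      using 1 norm_triangle_ineq[of "P v" "v - P v"] by (simp add: algebra_simps)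
    moreover have "inverse e + 2 > 0"
      using \<open>e > 0\<close> by (simp add: add_pos_pos)
    ultimately show ?thesis
      by (metis divide_inverse_commute mult.commute pos_divide_le_eq)
  qed
  \<comment> \<open>Testing with \<open>v = P w\<close> kills \<open>P w\<close> by coercivity; then
    \<open>T\<close> fixes \<open>w\<close>, and testing with \<open>v = w\<close> kills the
    rest.\<close>
  have dense: "w = 0" if w: "\<And>v. cinner (T v) w = 0" for w
  proof -
    have "cinner (Z (P w)) (P w) = 0"
      using w[of "P w"] by (metis TP ZP PZ cinner_orth_projection[OF P(2)])
    then have "cinner (P w) (Z (P w)) = 0"
      by (metis cinner_commute complex_cnj_zero)
    then have "P w = 0"
      using coercive[OF PP, of w] \<open>e > 0\<close> by (simp add: mult_le_0_iff)
    then have "T w = w"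
      using ZP[of w] by (simp add: Tv blinfun.zero_right)
    then show "w = 0"
      using w[of w] by (simp add: cinner_self)
  qed
  obtain S where SB: "S \<in> bounded_ops" and TS: "T o\<^sub>L S = id_blinfun" and ST: "S o\<^sub>L T = id_blinfun"
    using invertible_if_bounded_below[OF _ _ below dense] TA AB \<open>e > 0\<close>
    by (metis add_pos_pos inverse_positive_iff_positive subsetD zero_less_numeral)
  have SA: "S \<in> A"
    by (rule von_neumann_algebra_inverse[OF A TA SB TS ST])
  have TSv: "T (S v) = v" and STv: "S (T v) = v" for v
    by (metis TS ST blinfun_apply_blinfun_compose blinfun_apply_id_blinfun)+
  \<comment> \<open>\<open>T\<close> commutes with \<open>P\<close>, both products being
    \<open>Z\<close>, and so does its inverse. Hence \<open>S\<close> compresses to an inverse of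
    \<open>Z\<close> in the corner.\<close>
  have SP: "S (P v) = P (S v)" for v
    by (metis TSv STv PT TP)
  show thesis
  proof
    show "P o\<^sub>L S o\<^sub>L P \<in> compression A P"
      using SA by (auto simp: compression_def)
    show "Z o\<^sub>L (P o\<^sub>L S o\<^sub>L P) = P" "(P o\<^sub>L S o\<^sub>L P) o\<^sub>L Z = P"
      by (rule blinfun_eqI; simp; metis SP PP PT TP TSv STv)+
  qed
qed

section \<open>Compression of a positive operator and of its inverse\<close>

text \<open>Take for \<open>d\<close> a positive lower bound on the distance from \<open>z\<close>
  to the closed ray. For \<open>a > 0\<close>, factoring out \<open>a\<close> leaves the distance
  from \<open>z\<close> to the point \<open>b / a\<close> of the ray.\<close>

lemma dist_real_ray:
  assumes "z \<notin> complex_of_real ` {1..}"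
  obtains d where "d > 0" "\<And>a b. 0 \<le> a \<Longrightarrow> a \<le> b \<Longrightarrow> d * a \<le> cmod (z * of_real a - of_real b)"
proof -
  have "closed (complex_of_real ` {1..})"
    by (intro closed_injective_linear_image) (auto intro: injI bounded_linear.linear bounded_linear_of_real)
  then obtain d where d: "d > 0" "\<And>r. 1 \<le> r \<Longrightarrow> d \<le> dist z (complex_of_real r)"
    using separate_point_closed assms by (metis atLeast_iff image_eqI)
  have "d * a \<le> cmod (z * of_real a - of_real b)" if "0 \<le> a" "a \<le> b" for a b
  proof (cases "a = 0")
    case False
    have "z * of_real a - of_real b = (z - of_real (b / a)) * of_real a"
      using False by (simp add: field_simps)
    then have "cmod (z * of_real a - of_real b) = dist z (of_real (b / a)) * a"
      using that by (simp add: norm_mult dist_norm)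
    then show ?thesis
      using that False d(2)[of "b / a"] by (simp add: mult_right_mono)
  qed simp
  then show thesis
    using that d(1) by blast
qed

text \<open>The situation at one fixed time. The factorization turns the quadratic form of
  \<open>h\<close> into a squared norm of \<open>adj g x\<close>, so positivity is used without an
  operator square root.\<close>

locale positive_factorization =
  fixes g h k P :: "'h::chilbert_space opr"
  assumes g: "g \<in> bounded_ops" and h_def: "h = g o\<^sub>L adj g"
    and hk: "h o\<^sub>L k = id_blinfun" and kh: "k o\<^sub>L h = id_blinfun"
    and P: "orth_projection P"
begin

lemma cinner_h: "cinner (h x) y = cinner (adj g x) (adj g y)"
  by (simp add: h_def cinner_adj[OF g])

lemma h_sym: "cinner (h x) y = cinner x (h y)"
  by (metis cinner_h cinner_commute)

lemma h_self: "cinner x (h x) = complex_of_real ((norm (adj g x))\<^sup>2)"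
  by (metis cinner_h cinner_self h_sym)

lemma h_k [simp]: "h (k x) = x" and k_h [simp]: "k (h x) = x"
  by (metis hk kh blinfun_apply_blinfun_compose blinfun_apply_id_blinfun)+

text \<open>Writing \<open>x = h (k x)\<close> reduces this to the form of \<open>h\<close> at
  \<open>k x\<close>.\<close>

lemma k_self: "cinner x (k x) = complex_of_real ((norm (adj g (k x)))\<^sup>2)"
  by (metis cinner_h cinner_self h_k)

text \<open>Follows from \<open>x = g (adj g (k x))\<close>. The constant \<open>norm g + 1\<close>
  is positive outright and can therefore be inverted later.\<close>

lemma k_coercive: "(norm x)\<^sup>2 \<le> (norm g + 1)\<^sup>2 * (norm (adj g (k x)))\<^sup>2"
proof -
  have "norm x = norm (g (adj g (k x)))"
    using h_k[of x] by (simp add: h_def)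
  also have "\<dots> \<le> norm g * norm (adj g (k x))"
    by (rule norm_blinfun)
  also have "\<dots> \<le> (norm g + 1) * norm (adj g (k x))"
    by (simp add: mult_right_mono)
  finally show ?thesis
    by (simp add: power_mono flip: power_mult_distrib)
qed

text \<open>This is \<open>y \<le> y x y\<close> for \<open>x = P h P\<close> and \<open>y = P k P\<close>; it comes from
  \<open>\<langle>w, h w\<rangle> \<ge> 0\<close> for \<open>w = k v - P k v\<close>.\<close>

lemma compressed_inverse_le:
  assumes "P v = v"
  shows "(norm (adj g (k v)))\<^sup>2 \<le> (norm (adj g (P (k v))))\<^sup>2"
proof -
  let ?u = "P (k v)" and ?a = "complex_of_real ((norm (adj g (k v)))\<^sup>2)"
  have vu: "cinner v ?u = ?a"
    using k_self[of v] assms by (metis P cinner_orth_projection)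
  have uv: "cinner ?u v = ?a"
    using vu by (metis cinner_commute complex_cnj_complex_of_real)
  have "complex_of_real ((norm (adj g (k v - ?u)))\<^sup>2) = cinner (k v - ?u) (h (k v - ?u))"
    by (simp only: h_self)
  \<comment> \<open>Since \<open>h (k v) = v\<close>, the first three terms are \<open>?a\<close>,
    \<open>- ?a\<close> and \<open>- ?a\<close>; what remains is the form of \<open>h\<close> at
    \<open>?u\<close> minus \<open>?a\<close>.\<close>
  also have "\<dots> = cinner (k v) v - cinner ?u v - cinner v ?u + cinner ?u (h ?u)"
    using h_sym[of "k v" ?u] by (simp add: cinner_simps blinfun.diff_right)
  also have "cinner (k v) v = ?a"
    using k_self[of v] by (metis cinner_commute complex_cnj_complex_of_real)
  also have "?a - cinner ?u v - cinner v ?u + cinner ?u (h ?u)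
      = complex_of_real ((norm (adj g ?u))\<^sup>2 - (norm (adj g (k v)))\<^sup>2)"
    by (simp add: uv vu h_self)
  finally have "(norm (adj g (k v - ?u)))\<^sup>2 = (norm (adj g ?u))\<^sup>2 - (norm (adj g (k v)))\<^sup>2"
    using of_real_eq_iff by blast
  then show ?thesis
    by (metis diff_ge_0_iff_ge zero_le_power2)
qed

lemma spectrum_jacobi:
  assumes A: "von_neumann_algebra A" "P \<in> A" "h \<in> A" "k \<in> A"
  shows "spectrum_in (compression A P) P (P o\<^sub>L h o\<^sub>L P o\<^sub>L k o\<^sub>L P) \<subseteq> complex_of_real ` {1..}"
proof
  fix z
  let ?j = "P o\<^sub>L h o\<^sub>L P o\<^sub>L k o\<^sub>L P"
  assume z: "z \<in> spectrum_in (compression A P) P ?j"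
  show "z \<in> complex_of_real ` {1..}"
  proof (rule ccontr)
    assume "z \<notin> complex_of_real ` {1..}"
    then obtain d where d: "d > 0"
        "\<And>a b. 0 \<le> a \<Longrightarrow> a \<le> b \<Longrightarrow> d * a \<le> cmod (z * of_real a - of_real b)"
      using dist_real_ray by blast
    have star: "star_subalgebra A" and comp: "\<And>S T. S \<in> A \<Longrightarrow> T \<in> A \<Longrightarrow> S o\<^sub>L T \<in> A"
      and sc: "\<And>T. T \<in> A \<Longrightarrow> cscale z T \<in> A" and AB: "A \<subseteq> bounded_ops"
      using A(1) by (auto simp: von_neumann_algebra_def star_subalgebra_def)
    have lin: "T (z *\<^sub>C v) = z *\<^sub>C T v" if "T \<in> A" for T v
      using that AB by (auto simp: bounded_ops_def)
    note PP = orth_projection_idem[OF P]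
    define y where "y = P o\<^sub>L k o\<^sub>L P"
    define w where "w = cscale z P - ?j"
    \<comment> \<open>The product \<open>j\<close> of two self-adjoint factors need not be
      self-adjoint, but \<open>y j = y x y\<close> is; multiplying by \<open>y\<close> on the left
      makes the form of \<open>Z\<close> a combination of two real forms.\<close>
    define Z where "Z = y o\<^sub>L w"
    \<comment> \<open>The coercivity constant of \<open>k\<close> obtained from
      \<open>k_coercive\<close>.\<close>
    define \<delta> where "\<delta> = inverse ((norm g + 1)\<^sup>2)"
    have gpos: "norm g + 1 > 0"
      by (simp add: add_nonneg_pos)
    have \<delta>: "\<delta> > 0"
      using gpos by (simp add: \<delta>_def)
    have yv: "y v = P (k (P v))" and wv: "w v = z *\<^sub>C P v - P (h (P (k (P v))))" for v
      by (simp_all add: y_def w_def cscale_apply blinfun.diff_left)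
    have yA: "y \<in> A"
      unfolding y_def by (intro comp A)
    have wA: "w \<in> A"
      unfolding w_def by (intro comp A sc star_subalgebra_diff[OF star])
    have ZA: "Z \<in> A"
      unfolding Z_def by (intro comp yA wA)
    have Pz: "P (z *\<^sub>C v) = z *\<^sub>C P v" for v
      by (rule lin[OF A(2)])
    have Py: "P o\<^sub>L y = y" "y o\<^sub>L P = y" and Pw: "P o\<^sub>L w = w" "w o\<^sub>L P = w"
      by (auto intro!: blinfun_eqI simp: yv wv PP Pz blinfun.diff_right)
    have PZ: "P o\<^sub>L Z = Z" "Z o\<^sub>L P = Z"
      by (simp_all only: Z_def Py Pw blinfun_compose_assoc[of y w P] blinfun_compose_assoc[of P y w, symmetric])
    have lower: "\<delta> * (norm v)\<^sup>2 \<le> (norm (adj g (k v)))\<^sup>2" for v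
      using k_coercive[of v] gpos by (simp add: \<delta>_def field_simps)
    have y_form: "cinner v (y v) = complex_of_real ((norm (adj g (k v)))\<^sup>2)" if "P v = v" for v
      using k_self[of v] that by (metis P cinner_orth_projection yv)
    have "\<delta> * (norm v)\<^sup>2 \<le> cmod (cinner v (y v))" if "P v = v" for v
      using lower[of v] by (simp add: y_form[OF that] norm_power)
    then obtain Y where Y: "Y \<in> compression A P" "y o\<^sub>L Y = P" "Y o\<^sub>L y = P"
      using corner_invertible[OF A(1,2) P yA Py \<delta>] by blast
    have Z_form: "cinner v (Z v) = z * complex_of_real ((norm (adj g (k v)))\<^sup>2)
        - complex_of_real ((norm (adj g (P (k v))))\<^sup>2)" if v: "P v = v" for v
    proof -
      \<comment> \<open>\<open>k\<close> inherits symmetry from \<open>h\<close> by writing each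
        argument as \<open>h\<close> of its image under \<open>k\<close>.\<close>
      have y_sym: "cinner a (y b) = cinner (y a) b" for a b
        by (metis P cinner_orth_projection h_k h_sym yv)
      have "cinner v (Z v) = cinner (y v) (w v)"
        by (simp add: Z_def y_sym)
      also have "\<dots> = z * cinner (y v) v - cinner (P (k v)) (P (h (P (k v))))"
        by (simp add: wv v yv cinner_simps)
      also have "cinner (P (k v)) (P (h (P (k v)))) = cinner (P (k v)) (h (P (k v)))"
        by (metis P PP cinner_orth_projection)
      finally show ?thesis
        using y_form[OF v] by (simp add: h_self flip: y_sym)
    qed
    have "d * \<delta> * (norm v)\<^sup>2 \<le> cmod (cinner v (Z v))" if v: "P v = v" for v
    proof -
      have "d * \<delta> * (norm v)\<^sup>2 \<le> d * (norm (adj g (k v)))\<^sup>2"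
        using lower[of v] d(1) by (simp add: mult.assoc)
      \<comment> \<open>The distance estimate applies with the forms of \<open>y\<close> and
        \<open>y x y\<close> at \<open>v\<close> as \<open>a\<close> and \<open>b\<close>; their
        order is \<open>compressed_inverse_le\<close>.\<close>
      also have "\<dots> \<le> cmod (cinner v (Z v))"
        unfolding Z_form[OF v] by (intro d(2) compressed_inverse_le v) simp
      finally show ?thesis .
    qed
    then obtain S where S: "S \<in> compression A P" "Z o\<^sub>L S = P" "S o\<^sub>L Z = P"
      using corner_invertible[OF A(1,2) P ZA PZ] d(1) \<delta> by (metis mult_pos_pos)
    then obtain a where a: "a \<in> A" "S = P o\<^sub>L a o\<^sub>L P"
      by (auto simp: compression_def)
    have "S o\<^sub>L y = P o\<^sub>L (a o\<^sub>L y) o\<^sub>L P"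
      by (rule blinfun_eqI) (simp add: a(2) yv PP)
    then have "S o\<^sub>L y \<in> compression A P"
      using comp[OF a(1) yA] by (auto simp: compression_def)
    moreover have "(S o\<^sub>L y) o\<^sub>L w = P"
      using S(3) by (simp add: Z_def blinfun_compose_assoc)
    \<comment> \<open>\<open>S y\<close> is a left inverse of \<open>w\<close> by construction. It
      is also a right inverse: cancelling \<open>y\<close> by means of \<open>Y\<close> exposes
      \<open>Z S = P\<close>.\<close>
    moreover have "w o\<^sub>L (S o\<^sub>L y) = P"
    proof -
      have "w o\<^sub>L (S o\<^sub>L y) = (Y o\<^sub>L y) o\<^sub>L w o\<^sub>L (S o\<^sub>L y)"
        by (simp add: Y(3) Pw)
      also have "\<dots> = Y o\<^sub>L (Z o\<^sub>L S) o\<^sub>L y"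
        by (simp add: Z_def blinfun_compose_assoc)
      also have "\<dots> = P"
        by (simp add: S(2) blinfun_compose_assoc Py Y(3))
      finally show ?thesis .
    qed
    ultimately show False
      using z unfolding spectrum_in_def w_def by blast
  qed
qed

end

section \<open>Membership of the processes in the algebra, and the conclusion at time
  \<open>t\<close>\<close>

lemma free_circular_brownian_motion_in:
  assumes A: "star_subalgebra A" and c: "free_circular_brownian_motion A \<tau> c" and "0 \<le> t"
  shows "c t \<in> A"
proof -
  obtain x y where "x t \<in> A" "y t \<in> A"
      "c t = cscale (complex_of_real (1 / sqrt 2)) (x t + cscale \<i> (y t))"
    using c \<open>0 \<le> t\<close> unfolding free_circular_brownian_motion_def free_brownian_motion_def by blast
  then show ?thesis
    using A by (simp add: star_subalgebra_def)
qed

theorem lemma5p5: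
  fixes A :: "'h::chilbert_space opr set"
    and \<tau> :: "'h opr \<Rightarrow> complex"
    and c g h :: "real \<Rightarrow> 'h opr"
    and P :: "'h opr"
    and \<kappa> t :: real
  assumes "nc_prob_space A \<tau>"
    and "free_circular_brownian_motion A \<tau> c"
    and "free_multiplicative_brownian_motion \<tau> c g"
    and "\<And>s. 0 \<le> s \<Longrightarrow> h s = free_positive_brownian_motion g s"
    and "\<And>s. 0 \<le> s \<Longrightarrow> invertible_in A (h s)"
    and "P \<in> A" and "orth_projection P"
    and "\<tau> P = complex_of_real \<kappa>" and "0 < \<kappa>" and "\<kappa> \<le> 1"
    and "free_sets \<tau> {P} (h ` {0..})"
    and "0 \<le> t"
  shows "spectrum_in (compression A P) P (free_jacobi P h t) \<subseteq> complex_of_real ` {1..}"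
proof -
  have vN: "von_neumann_algebra A"
    using assms(1) by (simp add: nc_prob_space_def)
  then have star: "star_subalgebra A"
    by (simp add: von_neumann_algebra_def)
  have "c ` {0..t} \<subseteq> A"
    using free_circular_brownian_motion_in[OF star assms(2)] by auto
  \<comment> \<open>\<open>A\<close> is itself a von Neumann algebra containing the generators, so
    it contains their hull.\<close>
  then have "filtration c t \<subseteq> A"
    unfolding filtration_def by (rule hull_minimal) (rule vN)
  then have gA: "g t \<in> A"
    using assms(3,12) by (auto simp: free_multiplicative_brownian_motion_def)
  have h: "h t = g t o\<^sub>L adj (g t)"
    using assms(4)[OF assms(12)] by (simp add: free_positive_brownian_motion_def)
  obtain k where k: "k \<in> A" "h t o\<^sub>L k = id_blinfun" "k o\<^sub>L h t = id_blinfun"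
    using assms(5)[OF assms(12)] by (auto simp: invertible_in_def)
  \<comment> \<open>Two-sided inverses are unique, so the definite description in
    \<open>op_inverse\<close> denotes the inverse found in \<open>A\<close>.\<close>
  have "op_inverse (h t) = k"
    unfolding op_inverse_def
  proof (rule the_equality)
    show "y = k" if "h t o\<^sub>L y = id_blinfun \<and> y o\<^sub>L h t = id_blinfun" for y
      using that k by (intro blinfun_eqI)
        (metis blinfun_apply_blinfun_compose blinfun_apply_id_blinfun)
  qed (use k in simp)
  moreover interpret positive_factorization "g t" "h t" k P
    using gA star h k assms(7) by unfold_locales (auto simp: star_subalgebra_def)
  have "h t \<in> A"
    using h gA star by (simp add: star_subalgebra_def)
  then have "spectrum_in (compression A P) P (P o\<^sub>L h t o\<^sub>L P o\<^sub>L k o\<^sub>L P) \<subseteq> complex_of_real ` {1..}"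
    by (intro spectrum_jacobi vN assms(6) k(1))
  ultimately show ?thesis
    by (simp add: free_jacobi_def)
qed

end
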